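(* The quasi-linear system for two real functions $w(t,x),v(t,x)$ $$\begin{cases} w_t+(wv)_x=0,\\ v_t+\left(\frac{w^2}{2}-\frac{3v^2}{2}\right)_x=0\end{cases}\qquad( * )$$ is a reduction of the system $U_t+A(U)U_x=0$ for $n=4$ (written out in the context). The system $( * )$ is strictly hyperbolic outside the origin in the $(w,v)$ plane. Moreover, the sign of the nonlinearity of $( * )$ changes when $v$ changes sign.
   Context: For $n=4$ the system $U_t+A(U)U_x=0$ for $U=(u_1,u_2,u_3,u_4)$ reads $$(u_1)_t+(u_2)_x=0,\quad (u_2)_t+(u_3)_x-3u_1(u_1)_x=0,\quad (u_3)_t+(u_4)_x-2u_2(u_1)_x=0,\quad (u_4)_t-u_3(u_1)_x=0.$$ Reduction: define $U(w,v)=(u_1(w,v),\dots,u_4(w,v))$ as the coefficients in the polynomial identity in $p$ $$\tfrac15p^5+u_1p^3+u_2p^2+u_3p+u_4=\tfrac15\,(p-v-\sqrt5\,w)^2\,(p-v+\sqrt5\,w)^2\,(p+4v);$$ that $( * )$ is a reduction means that for every smooth solution $(w(t,x),v(t,x))$ of $( * )$ the function $U(w(t,x),v(t,x))$ solves the $n=4$ system. Strict hyperbolicity at a point $(w,v)$ means that the coefficient matrix $\begin{pmatrix} v& w\\ w&-3v\end{pmatrix}$ of $( * )$ has two distinct real eigenvalues there; these are $\lambda_{1,2}=-v\pm R$, $R=\sqrt{4v^2+w^2}$. The nonlinearity of an eigenvalue is its derivative with respect to the corresponding Riemann invariant, computed as the derivative of the eigenvalue in the direction of its eigenvector; for $\lambda_1$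 it is $\frac{\partial\lambda_1}{\partial r_1}=d\lambda_1(\xi_1)$ with the eigenvector $\xi_1=(w,R-2v)$. *)

theory Defs
  imports "HOL-Analysis.Analysis" "HOL-Computational_Algebra.Polynomial"
begin

text \<open>Points of the \<open>(t,x)\<close>-plane are pairs, with time as the first component.\<close>

definition partial_t :: "(real \<times> real \<Rightarrow> real) \<Rightarrow> real \<times> real \<Rightarrow> real" where
  "partial_t f z = deriv (\<lambda>s. f (s, snd z)) (fst z)"

definition partial_x :: "(real \<times> real \<Rightarrow> real) \<Rightarrow> real \<times> real \<Rightarrow> real" where
  "partial_x f z = deriv (\<lambda>s. f (fst z, s)) (snd z)"

definition C1_on :: "(real \<times> real) set \<Rightarrow> (real \<times> real \<Rightarrow> real) \<Rightarrow> bool" where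
  "C1_on \<Omega> f \<longleftrightarrow> (\<exists>f'. (\<forall>z\<in>\<Omega>. (f has_derivative blinfun_apply (f' z)) (at z)) \<and> continuous_on \<Omega> f')"

text \<open>
  Solutions of both systems are classical solutions of class \<open>C\<^sup>1\<close> on an open set \<open>\<Omega>\<close>;
  this includes all \<open>C\<close>-infinity solutions.
\<close>

definition solves_n4_system :: "(real \<times> real) set \<Rightarrow> (real \<times> real \<Rightarrow> real ^ 4) \<Rightarrow> bool" where
  "solves_n4_system \<Omega> U \<longleftrightarrow>
     (let u1 = (\<lambda>z. U z $ 1); u2 = (\<lambda>z. U z $ 2); u3 = (\<lambda>z. U z $ 3); u4 = (\<lambda>z. U z $ 4) in
      C1_on \<Omega> u1 \<and> C1_on \<Omega> u2 \<and> C1_on \<Omega> u3 \<and> C1_on \<Omega> u4 \<and>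
      (\<forall>z\<in>\<Omega>.
         partial_t u1 z + partial_x u2 z = 0 \<and>
         partial_t u2 z + partial_x u3 z - 3 * u1 z * partial_x u1 z = 0 \<and>
         partial_t u3 z + partial_x u4 z - 2 * u2 z * partial_x u1 z = 0 \<and>
         partial_t u4 z - u3 z * partial_x u1 z = 0))"

definition solves_wv_system ::
  "(real \<times> real) set \<Rightarrow> (real \<times> real \<Rightarrow> real) \<Rightarrow> (real \<times> real \<Rightarrow> real) \<Rightarrow> bool" where
  "solves_wv_system \<Omega> w v \<longleftrightarrow>
     C1_on \<Omega> w \<and> C1_on \<Omega> v \<and>
     (\<forall>z\<in>\<Omega>.
        partial_t w z + partial_x (\<lambda>y. w y * v y) z = 0 \<and>
        partial_t v z + partial_x (\<lambda>y. (w y)\<^sup>2 / 2 - 3 * (v y)\<^sup>2 / 2) z = 0)"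

definition wv_poly :: "real \<Rightarrow> real \<Rightarrow> real poly" where
  "wv_poly w v =
     smult (1/5) ([:- v - sqrt 5 * w, 1:]\<^sup>2 * [:- v + sqrt 5 * w, 1:]\<^sup>2 * [:4 * v, 1:])"

definition U_of :: "real \<Rightarrow> real \<Rightarrow> real ^ 4" where
  "U_of w v = vector [coeff (wv_poly w v) 3, coeff (wv_poly w v) 2,
                      coeff (wv_poly w v) 1, coeff (wv_poly w v) 0]"

lemma vector_4_nth:
  "(vector [a, b, c, d] :: 'a::zero ^ 4) $ 1 = a"
  "(vector [a, b, c, d] :: 'a::zero ^ 4) $ 2 = b"
  "(vector [a, b, c, d] :: 'a::zero ^ 4) $ 3 = c"
  "(vector [a, b, c, d] :: 'a::zero ^ 4) $ 4 = d"
  unfolding vector_def by simp_all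

lemma wv_poly_explicit:
  "wv_poly w v =
     [:4/5 * v^5 - 8 * w^2 * v^3 + 20 * w^4 * v,
       - 3 * v^4 + 14 * w^2 * v^2 + 5 * w^4,
       4 * v^3 - 4 * w^2 * v,
       - 2 * v^2 - 2 * w^2, 0, 1/5:]"
proof -
  have "[:- v - sqrt 5 * w, 1:] * [:- v + sqrt 5 * w, 1:] = [:v^2 - 5 * w^2, - 2 * v, 1:]"
    by (simp add: algebra_simps power2_eq_square)
  then have "[:- v - sqrt 5 * w, 1:]\<^sup>2 * [:- v + sqrt 5 * w, 1:]\<^sup>2 = [:v^2 - 5 * w^2, - 2 * v, 1:]\<^sup>2"
    by (metis power_mult_distrib)
  then show ?thesis
    unfolding wv_poly_def by (simp add: power2_eq_square) (simp add: algebra_simps power_numeral_reduce)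
qed

text \<open>The polynomial identity in \<open>p\<close> that characterizes \<^const>\<open>U_of\<close>.\<close>

lemma U_of_poly_identity:
  "1/5 * p^5 + U_of w v $ 1 * p^3 + U_of w v $ 2 * p^2 + U_of w v $ 3 * p + U_of w v $ 4 =
   1/5 * (p - v - sqrt 5 * w)\<^sup>2 * (p - v + sqrt 5 * w)\<^sup>2 * (p + 4 * v)"
proof -
  have "poly (wv_poly w v) p = 1/5 * (p - v - sqrt 5 * w)\<^sup>2 * (p - v + sqrt 5 * w)\<^sup>2 * (p + 4 * v)"
    unfolding wv_poly_def by (simp add: algebra_simps)
  moreover have "poly (wv_poly w v) p =
      1/5 * p^5 + U_of w v $ 1 * p^3 + U_of w v $ 2 * p^2 + U_of w v $ 3 * p + U_of w v $ 4"
    unfolding U_of_def vector_4_nth wv_poly_explicit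
    by (simp add: eval_nat_numeral algebra_simps)
  ultimately show ?thesis by simp
qed

definition is_eigenvector :: "real ^ 'n ^ 'n \<Rightarrow> real \<Rightarrow> real ^ 'n \<Rightarrow> bool" where
  "is_eigenvector A c \<xi> \<longleftrightarrow> \<xi> \<noteq> 0 \<and> A *v \<xi> = c *\<^sub>R \<xi>"

definition eigenvalues :: "real ^ 'n ^ 'n \<Rightarrow> real set" where
  "eigenvalues A = {c. \<exists>\<xi>. is_eigenvector A c \<xi>}"

definition strictly_hyperbolic_at :: "(real ^ 'n \<Rightarrow> real ^ 'n ^ 'n) \<Rightarrow> real ^ 'n \<Rightarrow> bool" where
  "strictly_hyperbolic_at A P \<longleftrightarrow> card (eigenvalues (A P)) = CARD('n)"

text \<open>States of the system for \<open>w\<close> and \<open>v\<close> are vectors \<open>P\<close> with \<open>P $ 1 = w\<close> and \<open>P $ 2 = v\<close>.\<close>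

definition wv_flux :: "real ^ 2 \<Rightarrow> real ^ 2" where
  "wv_flux P = vector [P $ 1 * P $ 2, (P $ 1)\<^sup>2 / 2 - 3 * (P $ 2)\<^sup>2 / 2]"

definition wv_matrix :: "real ^ 2 \<Rightarrow> real ^ 2 ^ 2" where
  "wv_matrix P = vector [vector [P $ 2, P $ 1], vector [P $ 1, - 3 * P $ 2]]"

lemma wv_flux_has_derivative: "(wv_flux has_derivative (\<lambda>h. wv_matrix P *v h)) (at P)"
proof -
  have nth: "((\<lambda>Q::real^2. Q $ i) has_derivative (\<lambda>h. h $ i)) (at P)" for i
    by (rule bounded_linear_imp_has_derivative) (rule bounded_linear_vec_nth)
  have "((\<lambda>Q. wv_flux Q $ i) has_derivative (\<lambda>h. (wv_matrix P *v h) $ i)) (at P)" for i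
  proof -
    consider "i = 1" | "i = 2" using exhaust_2 by blast
    then show ?thesis
      by cases (auto simp: wv_flux_def wv_matrix_def matrix_vector_mult_def sum_2
          intro!: derivative_eq_intros nth)
  qed
  then show ?thesis
    by (subst has_derivative_componentwise_within) (auto simp: Basis_vec_def inner_axis)
qed

definition wv_R :: "real ^ 2 \<Rightarrow> real" where
  "wv_R P = sqrt (4 * (P $ 2)\<^sup>2 + (P $ 1)\<^sup>2)"

definition lambda1 :: "real ^ 2 \<Rightarrow> real" where
  "lambda1 P = - P $ 2 + wv_R P"

definition lambda2 :: "real ^ 2 \<Rightarrow> real" where
  "lambda2 P = - P $ 2 - wv_R P"

text \<open>
  \<open>xi1\<close> vanishes exactly on the ray \<open>w = 0\<close>, \<open>v \<ge> 0\<close>, and \<open>xi2\<close> exactly on the ray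
  \<open>w = 0\<close>, \<open>v \<le> 0\<close>; there they are not eigenvectors.
\<close>

definition xi1 :: "real ^ 2 \<Rightarrow> real ^ 2" where
  "xi1 P = vector [P $ 1, wv_R P - 2 * P $ 2]"

definition xi2 :: "real ^ 2 \<Rightarrow> real ^ 2" where
  "xi2 P = vector [P $ 1, - wv_R P - 2 * P $ 2]"

text \<open>
  The derivative of an eigenvalue with respect to its Riemann invariant: the differential of
  the eigenvalue applied to the eigenvector field.
\<close>

definition nonlinearity :: "(real ^ 'n \<Rightarrow> real) \<Rightarrow> (real ^ 'n \<Rightarrow> real ^ 'n) \<Rightarrow> real ^ 'n \<Rightarrow> real" where
  "nonlinearity lam \<xi> P = frechet_derivative lam (at P) (\<xi> P)"

end

theory Submission
  imports Defs
begin

subsection \<open>Partial derivatives and the class \<open>C\<^sup>1\<close>\<close>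

lemma partial_t_eq:
  assumes "(f has_derivative D) (at z)"
  shows "partial_t f z = D (1, 0)"
proof -
  interpret D: bounded_linear D
    using assms by (rule has_derivative_bounded_linear)
  have "((\<lambda>s. (s, snd z)) has_derivative (\<lambda>h. (h, 0))) (at (fst z))"
    by (auto intro!: derivative_eq_intros)
  moreover have "(f has_derivative D) (at (fst z, snd z))"
    using assms by simp
  ultimately have "((\<lambda>s. f (s, snd z)) has_derivative (\<lambda>h. D (h, 0))) (at (fst z))"
    by (rule has_derivative_compose)
  \<comment> \<open>A linear map on the reals is multiplication by its value at 1, the form in which
    \<open>deriv\<close> reads a derivative.\<close>
  moreover have "(\<lambda>h. D (h, 0)) = (*) (D (1, 0))"
  proof
    show "D (h, 0) = D (1, 0) * h" for h
      using D.scaleR[of h "(1, 0)"] by (simp only: scaleR_Pair) (simp add: mult.commute)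
  qed
  ultimately show ?thesis
    unfolding partial_t_def by (intro DERIV_imp_deriv) (simp only: has_field_derivative_def)
qed

lemma partial_x_eq:
  assumes "(f has_derivative D) (at z)"
  shows "partial_x f z = D (0, 1)"
proof -
  interpret D: bounded_linear D
    using assms by (rule has_derivative_bounded_linear)
  have "((\<lambda>s. (fst z, s)) has_derivative (\<lambda>h. (0, h))) (at (snd z))"
    by (auto intro!: derivative_eq_intros)
  moreover have "(f has_derivative D) (at (fst z, snd z))"
    using assms by simp
  ultimately have "((\<lambda>s. f (fst z, s)) has_derivative (\<lambda>h. D (0, h))) (at (snd z))"
    by (rule has_derivative_compose)
  moreover have "(\<lambda>h. D (0, h)) = (*) (D (0, 1))"
  proof
    show "D (0, h) = D (0, 1) * h" for h
      using D.scaleR[of h "(0, 1)"] by (simp only: scaleR_Pair) (simp add: mult.commute)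
  qed
  ultimately show ?thesis
    unfolding partial_x_def by (intro DERIV_imp_deriv) (simp only: has_field_derivative_def)
qed

lemma C1_on_has_derivative:
  assumes "C1_on \<Omega> f" "z \<in> \<Omega>"
  obtains D where "(f has_derivative D) (at z)"
  using assms unfolding C1_on_def by blast

text \<open>Needed for products: the derivative f g' + g f' is continuous only if f and g
  are.\<close>

lemma C1_on_imp_continuous_on:
  assumes "C1_on \<Omega> f"
  shows "continuous_on \<Omega> f"
proof (rule has_derivative_continuous_on)
  fix z assume "z \<in> \<Omega>"
  with assms show "(f has_derivative (SOME D. (f has_derivative D) (at z))) (at z within \<Omega>)"
    by (metis C1_on_has_derivative has_derivative_at_withinI someI)
qed

lemma C1_on_const: "C1_on \<Omega> (\<lambda>z. c)"
  unfolding C1_on_def by (intro exI[of _ "\<lambda>_. 0"]) (auto simp: zero_blinfun.rep_eq)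

lemma C1_on_add:
  assumes "C1_on \<Omega> f" "C1_on \<Omega> g"
  shows "C1_on \<Omega> (\<lambda>z. f z + g z)"
proof -
  obtain f' g' where
    "\<forall>z\<in>\<Omega>. (f has_derivative blinfun_apply (f' z)) (at z)" "continuous_on \<Omega> f'"
    "\<forall>z\<in>\<Omega>. (g has_derivative blinfun_apply (g' z)) (at z)" "continuous_on \<Omega> g'"
    using assms unfolding C1_on_def by blast
  then show ?thesis
    unfolding C1_on_def
    by (intro exI[of _ "\<lambda>z. f' z + g' z"])
      (auto intro!: derivative_eq_intros continuous_intros simp: blinfun.bilinear_simps)
qed

lemma C1_on_mult:
  assumes "C1_on \<Omega> f" "C1_on \<Omega> g"
  shows "C1_on \<Omega> (\<lambda>z. f z * g z)"
proof -
  obtain f' g' where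
    "\<forall>z\<in>\<Omega>. (f has_derivative blinfun_apply (f' z)) (at z)" "continuous_on \<Omega> f'"
    "\<forall>z\<in>\<Omega>. (g has_derivative blinfun_apply (g' z)) (at z)" "continuous_on \<Omega> g'"
    using assms unfolding C1_on_def by blast
  with assms[THEN C1_on_imp_continuous_on] show ?thesis
    unfolding C1_on_def
    by (intro exI[of _ "\<lambda>z. f z *\<^sub>R g' z + g z *\<^sub>R f' z"])
      (auto intro!: derivative_eq_intros continuous_intros simp: blinfun.bilinear_simps)
qed

lemma C1_on_diff:
  assumes "C1_on \<Omega> f" "C1_on \<Omega> g"
  shows "C1_on \<Omega> (\<lambda>z. f z - g z)"
  using C1_on_add[OF assms(1) C1_on_mult[OF C1_on_const[of \<Omega> "- 1"] assms(2)]] by simp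

lemma C1_on_power:
  assumes "C1_on \<Omega> f"
  shows "C1_on \<Omega> (\<lambda>z. f z ^ n)"
  by (induction n) (simp_all add: C1_on_const C1_on_mult assms)

lemmas C1_on_intros = C1_on_const C1_on_add C1_on_mult C1_on_diff C1_on_power

subsection \<open>The reduction\<close>

lemma U_of_nth:
  "U_of w v $ 1 = - 2 * v^2 - 2 * w^2"
  "U_of w v $ 2 = 4 * v^3 - 4 * w^2 * v"
  "U_of w v $ 3 = - 3 * v^4 + 14 * w^2 * v^2 + 5 * w^4"
  "U_of w v $ 4 = 4/5 * v^5 - 8 * w^2 * v^3 + 20 * w^4 * v"
  unfolding U_of_def vector_4_nth wv_poly_explicit by (simp_all add: eval_nat_numeral)

text \<open>Chain rule for the explicit polynomials: the factors of V and W are the partial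
  derivatives in v and w.\<close>

lemma U_of_has_derivative:
  assumes "(w has_derivative W) (at z)" "(v has_derivative V) (at z)"
  shows
    "((\<lambda>y. U_of (w y) (v y) $ 1) has_derivative (\<lambda>h. - 4 * v z * V h - 4 * w z * W h)) (at z)"
    "((\<lambda>y. U_of (w y) (v y) $ 2) has_derivative
      (\<lambda>h. (12 * v z ^ 2 - 4 * w z ^ 2) * V h - 8 * w z * v z * W h)) (at z)"
    "((\<lambda>y. U_of (w y) (v y) $ 3) has_derivative
      (\<lambda>h. (28 * w z ^ 2 * v z - 12 * v z ^ 3) * V h
         + (28 * w z * v z ^ 2 + 20 * w z ^ 3) * W h)) (at z)"
    "((\<lambda>y. U_of (w y) (v y) $ 4) has_derivative
      (\<lambda>h. (4 * v z ^ 4 - 24 * w z ^ 2 * v z ^ 2 + 20 * w z ^ 4) * V h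
         + (80 * w z ^ 3 * v z - 16 * w z * v z ^ 3) * W h)) (at z)"
  unfolding U_of_nth
  by (rule derivative_eq_intros assms refl | simp add: fun_eq_iff field_simps power_numeral_reduce)+

lemma U_of_solves_n4_system:
  assumes "solves_wv_system \<Omega> w v"
  shows "solves_n4_system \<Omega> (\<lambda>z. U_of (w z) (v z))"
proof -
  have C1: "C1_on \<Omega> w" "C1_on \<Omega> v"
    and eq: "\<And>z. z \<in> \<Omega> \<Longrightarrow> partial_t w z + partial_x (\<lambda>y. w y * v y) z = 0"
      "\<And>z. z \<in> \<Omega> \<Longrightarrow> partial_t v z + partial_x (\<lambda>y. (w y)\<^sup>2 / 2 - 3 * (v y)\<^sup>2 / 2) z = 0"
    using assms unfolding solves_wv_system_def by auto
  have C1_U: "C1_on \<Omega> (\<lambda>z. U_of (w z) (v z) $ 1)" "C1_on \<Omega> (\<lambda>z. U_of (w z) (v z) $ 2)"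
    "C1_on \<Omega> (\<lambda>z. U_of (w z) (v z) $ 3)" "C1_on \<Omega> (\<lambda>z. U_of (w z) (v z) $ 4)"
    unfolding U_of_nth by (intro C1_on_intros C1)+
  have "partial_t (\<lambda>z. U_of (w z) (v z) $ 1) z + partial_x (\<lambda>z. U_of (w z) (v z) $ 2) z = 0 \<and>
      partial_t (\<lambda>z. U_of (w z) (v z) $ 2) z + partial_x (\<lambda>z. U_of (w z) (v z) $ 3) z
        - 3 * U_of (w z) (v z) $ 1 * partial_x (\<lambda>z. U_of (w z) (v z) $ 1) z = 0 \<and>
      partial_t (\<lambda>z. U_of (w z) (v z) $ 3) z + partial_x (\<lambda>z. U_of (w z) (v z) $ 4) z
        - 2 * U_of (w z) (v z) $ 2 * partial_x (\<lambda>z. U_of (w z) (v z) $ 1) z = 0 \<and>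
      partial_t (\<lambda>z. U_of (w z) (v z) $ 4) z
        - U_of (w z) (v z) $ 3 * partial_x (\<lambda>z. U_of (w z) (v z) $ 1) z = 0"
    if z: "z \<in> \<Omega>" for z
  proof -
    obtain W where W: "(w has_derivative W) (at z)"
      using C1(1) z by (rule C1_on_has_derivative)
    obtain V where V: "(v has_derivative V) (at z)"
      using C1(2) z by (rule C1_on_has_derivative)
    have "((\<lambda>y. w y * v y) has_derivative (\<lambda>h. w z * V h + W h * v z)) (at z)"
      using W V by (rule has_derivative_mult)
    then have Wt: "W (1, 0) = - (w z * V (0, 1) + W (0, 1) * v z)"
      using eq(1)[OF z] by (simp add: partial_t_eq[OF W] partial_x_eq)
    have "((\<lambda>y. (w y)\<^sup>2 / 2 - 3 * (v y)\<^sup>2 / 2) has_derivative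
        (\<lambda>h. w z * W h - 3 * v z * V h)) (at z)"
      by (auto intro!: derivative_eq_intros W V)
    then have Vt: "V (1, 0) = - (w z * W (0, 1) - 3 * v z * V (0, 1))"
      using eq(2)[OF z] by (simp add: partial_t_eq[OF V] partial_x_eq)
    note dU = U_of_has_derivative[OF W V]
    show ?thesis
      unfolding dU[THEN partial_t_eq] dU[THEN partial_x_eq]
      unfolding U_of_nth Wt Vt
      \<comment> \<open>With time derivatives eliminated, each equation is a polynomial identity in
        w, v, w_x = \<open>W (0, 1)\<close> and v_x = \<open>V (0, 1)\<close>.\<close>
      by (intro conjI; algebra)
  qed
  with C1_U show ?thesis
    unfolding solves_n4_system_def Let_def by blast
qed

subsection \<open>Eigenvalues and eigenvectors\<close>

lemma vec2_eq_iff: "(x :: 'a ^ 2) = y \<longleftrightarrow> x $ 1 = y $ 1 \<and> x $ 2 = y $ 2"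
  by (simp add: vec_eq_iff forall_2)

lemma is_eigenvector_wv_matrix:
  "is_eigenvector (wv_matrix P) c \<xi> \<longleftrightarrow>
     (\<xi> $ 1 \<noteq> 0 \<or> \<xi> $ 2 \<noteq> 0) \<and>
     P $ 2 * \<xi> $ 1 + P $ 1 * \<xi> $ 2 = c * \<xi> $ 1 \<and>
     P $ 1 * \<xi> $ 1 - 3 * P $ 2 * \<xi> $ 2 = c * \<xi> $ 2"
  by (auto simp: is_eigenvector_def wv_matrix_def matrix_vector_mult_def sum_2 vec2_eq_iff)

lemma wv_R_squared: "(wv_R P)\<^sup>2 = 4 * (P $ 2)\<^sup>2 + (P $ 1)\<^sup>2"
  by (simp add: wv_R_def)

lemma wv_R_pos:
  assumes "P \<noteq> 0"
  shows "wv_R P > 0"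
proof -
  have "4 * (P $ 2)\<^sup>2 + (P $ 1)\<^sup>2 > 0"
    using assms by (auto simp: vec2_eq_iff add_pos_nonneg add_nonneg_pos)
  then show ?thesis by (simp add: wv_R_def)
qed

text \<open>R^2 exceeds (2v)^2 by w^2, which settles w \<noteq> 0 with v \<ge> 0; for v < 0 the
  right side is negative.\<close>

lemma wv_R_gt_2v:
  assumes "P $ 1 \<noteq> 0 \<or> P $ 2 < 0"
  shows "wv_R P > 2 * P $ 2"
proof (cases "P $ 2 < 0")
  case True
  then have "P \<noteq> 0" by auto
  then show ?thesis using wv_R_pos[of P] True by linarith
next
  case False
  with assms have "(2 * P $ 2)\<^sup>2 < 4 * (P $ 2)\<^sup>2 + (P $ 1)\<^sup>2"
    by (simp add: power_mult_distrib)
  then show ?thesis unfolding wv_R_def by (rule real_less_rsqrt)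
qed

lemma wv_R_gt_minus_2v:
  assumes "P $ 1 \<noteq> 0 \<or> P $ 2 > 0"
  shows "wv_R P > - 2 * P $ 2"
proof -
  \<comment> \<open>R is even, so reflection in the origin reduces this to
    \<open>wv_R_gt_2v\<close>.\<close>
  have "wv_R (- P) > 2 * (- P) $ 2"
    using assms by (intro wv_R_gt_2v) auto
  then show ?thesis by (simp add: wv_R_def)
qed

text \<open>The first row holds identically and the second reduces to R^2 = 4v^2 + w^2; the second
  entry R - 2v is positive, so the vector is nonzero.\<close>

lemma is_eigenvector_xi1:
  assumes "P $ 1 \<noteq> 0 \<or> P $ 2 < 0"
  shows "is_eigenvector (wv_matrix P) (lambda1 P) (xi1 P)"
  using wv_R_gt_2v[OF assms] wv_R_squared[of P]
  unfolding is_eigenvector_wv_matrix xi1_def lambda1_def vector_2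
  by (auto simp: algebra_simps power2_eq_square)

lemma is_eigenvector_xi2:
  assumes "P $ 1 \<noteq> 0 \<or> P $ 2 > 0"
  shows "is_eigenvector (wv_matrix P) (lambda2 P) (xi2 P)"
  using wv_R_gt_minus_2v[OF assms] wv_R_squared[of P]
  unfolding is_eigenvector_wv_matrix xi2_def lambda2_def vector_2
  by (auto simp: algebra_simps power2_eq_square)

text \<open>On the ray where \<^const>\<open>xi1\<close> (or \<^const>\<open>xi2\<close>) vanishes, \<open>(1, 0)\<close> is an eigenvector.\<close>

lemma eigenvalues_wv_matrix:
  "eigenvalues (wv_matrix P) = {lambda1 P, lambda2 P}"
proof (intro equalityI subsetI)
  fix c assume "c \<in> eigenvalues (wv_matrix P)"
  then obtain \<xi> where "is_eigenvector (wv_matrix P) c \<xi>"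
    by (auto simp: eigenvalues_def)
  then have ne: "\<xi> $ 1 \<noteq> 0 \<or> \<xi> $ 2 \<noteq> 0"
    and 1: "P $ 2 * \<xi> $ 1 + P $ 1 * \<xi> $ 2 = c * \<xi> $ 1"
    and 2: "P $ 1 * \<xi> $ 1 - 3 * P $ 2 * \<xi> $ 2 = c * \<xi> $ 2"
    by (auto simp: is_eigenvector_wv_matrix)
  \<comment> \<open>The factor is the characteristic polynomial at c; eliminating one entry of the
    eigenvector shows that it annihilates the other.\<close>
  have "((c + P $ 2)\<^sup>2 - (4 * (P $ 2)\<^sup>2 + (P $ 1)\<^sup>2)) * \<xi> $ 1 = 0"
    using 1 2 by algebra
  moreover have "((c + P $ 2)\<^sup>2 - (4 * (P $ 2)\<^sup>2 + (P $ 1)\<^sup>2)) * \<xi> $ 2 = 0"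
    using 1 2 by algebra
  ultimately have "(c + P $ 2)\<^sup>2 = (wv_R P)\<^sup>2"
    using ne by (auto simp: wv_R_squared)
  then show "c \<in> {lambda1 P, lambda2 P}"
    by (auto simp: power2_eq_iff lambda1_def lambda2_def)
next
  have "\<exists>\<xi>. is_eigenvector (wv_matrix P) (lambda1 P) \<xi>"
  proof (cases "P $ 1 \<noteq> 0 \<or> P $ 2 < 0")
    case False
    \<comment> \<open>Here w = 0 and v \<ge> 0: the matrix is diagonal, R = 2v, and
      \<open>lambda1 P\<close> is its first entry v.\<close>
    then have "is_eigenvector (wv_matrix P) (lambda1 P) (vector [1, 0])"
      by (simp add: is_eigenvector_wv_matrix lambda1_def wv_R_def real_sqrt_mult)
    then show ?thesis ..
  qed (use is_eigenvector_xi1 in blast)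
  moreover have "\<exists>\<xi>. is_eigenvector (wv_matrix P) (lambda2 P) \<xi>"
  proof (cases "P $ 1 \<noteq> 0 \<or> P $ 2 > 0")
    case False
    then have "is_eigenvector (wv_matrix P) (lambda2 P) (vector [1, 0])"
      by (simp add: is_eigenvector_wv_matrix lambda2_def wv_R_def real_sqrt_mult)
    then show ?thesis ..
  qed (use is_eigenvector_xi2 in blast)
  ultimately show "c \<in> eigenvalues (wv_matrix P)" if "c \<in> {lambda1 P, lambda2 P}" for c
    using that by (auto simp: eigenvalues_def)
qed

lemma strictly_hyperbolic_wv_matrix:
  assumes "P \<noteq> 0"
  shows "strictly_hyperbolic_at wv_matrix P"
proof -
  have "lambda1 P \<noteq> lambda2 P"
    using wv_R_pos[OF assms] by (simp add: lambda1_def lambda2_def)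
  then show ?thesis
    by (simp add: strictly_hyperbolic_at_def eigenvalues_wv_matrix)
qed

subsection \<open>Nonlinearity\<close>

lemma wv_R_has_derivative:
  assumes "P \<noteq> 0"
  shows "(wv_R has_derivative (\<lambda>h. (4 * P $ 2 * h $ 2 + P $ 1 * h $ 1) / wv_R P)) (at P)"
proof -
  have nth: "((\<lambda>Q::real^2. Q $ i) has_derivative (\<lambda>h. h $ i)) (at P)" for i
    by (rule bounded_linear_imp_has_derivative) (rule bounded_linear_vec_nth)
  have "4 * (P $ 2)\<^sup>2 + (P $ 1)\<^sup>2 > 0"
    using wv_R_pos[OF assms] by (simp add: wv_R_def)
  then show ?thesis
    unfolding wv_R_def
    by (auto intro!: derivative_eq_intros nth simp: field_simps)
qed

lemma lambda_has_derivative: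
  assumes "P \<noteq> 0"
  shows "(lambda1 has_derivative
      (\<lambda>h. - h $ 2 + (4 * P $ 2 * h $ 2 + P $ 1 * h $ 1) / wv_R P)) (at P)"
    and "(lambda2 has_derivative
      (\<lambda>h. - h $ 2 - (4 * P $ 2 * h $ 2 + P $ 1 * h $ 1) / wv_R P)) (at P)"
proof -
  have nth: "((\<lambda>Q::real^2. Q $ i) has_derivative (\<lambda>h. h $ i)) (at P)" for i
    by (rule bounded_linear_imp_has_derivative) (rule bounded_linear_vec_nth)
  note R = wv_R_has_derivative[OF assms]
  show "(lambda1 has_derivative
      (\<lambda>h. - h $ 2 + (4 * P $ 2 * h $ 2 + P $ 1 * h $ 1) / wv_R P)) (at P)"
    unfolding lambda1_def by (intro has_derivative_add has_derivative_minus nth R)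
  show "(lambda2 has_derivative
      (\<lambda>h. - h $ 2 - (4 * P $ 2 * h $ 2 + P $ 1 * h $ 1) / wv_R P)) (at P)"
    unfolding lambda2_def by (intro has_derivative_diff has_derivative_minus nth R)
qed

text \<open>Over the denominator R the differential along \<open>xi1\<close> is -R^2 + 6vR - 8v^2 +
  w^2, and w^2 - R^2 = -4v^2 makes it 6v(R - 2v).\<close>

lemma nonlinearity_lambda1:
  assumes "P \<noteq> 0"
  shows "nonlinearity lambda1 xi1 P = 6 * P $ 2 * ((wv_R P - 2 * P $ 2) / wv_R P)"
  using wv_R_pos[OF assms] wv_R_squared[of P]
  unfolding nonlinearity_def frechet_derivative_at[OF lambda_has_derivative(1)[OF assms], symmetric]
  by (simp add: xi1_def field_simps power2_eq_square)

lemma nonlinearity_lambda2: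
  assumes "P \<noteq> 0"
  shows "nonlinearity lambda2 xi2 P = 6 * P $ 2 * ((wv_R P + 2 * P $ 2) / wv_R P)"
  using wv_R_pos[OF assms] wv_R_squared[of P]
  unfolding nonlinearity_def frechet_derivative_at[OF lambda_has_derivative(2)[OF assms], symmetric]
  by (simp add: xi2_def field_simps power2_eq_square)

lemma sgn_nonlinearity_lambda1:
  assumes "P $ 1 \<noteq> 0 \<or> P $ 2 < 0"
  shows "sgn (nonlinearity lambda1 xi1 P) = sgn (P $ 2)"
proof -
  have "P \<noteq> 0" using assms by auto
  then have "(wv_R P - 2 * P $ 2) / wv_R P > 0"
    using wv_R_gt_2v[OF assms] wv_R_pos by simp
  then have "sgn ((wv_R P - 2 * P $ 2) / wv_R P) = 1"
    by (rule sgn_pos)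
  then show ?thesis
    unfolding nonlinearity_lambda1[OF \<open>P \<noteq> 0\<close>] sgn_mult by (simp only:) simp
qed

lemma sgn_nonlinearity_lambda2:
  assumes "P $ 1 \<noteq> 0 \<or> P $ 2 > 0"
  shows "sgn (nonlinearity lambda2 xi2 P) = sgn (P $ 2)"
proof -
  have "P \<noteq> 0" using assms by auto
  then have "(wv_R P + 2 * P $ 2) / wv_R P > 0"
    using wv_R_gt_minus_2v[OF assms] wv_R_pos by simp
  then have "sgn ((wv_R P + 2 * P $ 2) / wv_R P) = 1"
    by (rule sgn_pos)
  then show ?thesis
    unfolding nonlinearity_lambda2[OF \<open>P \<noteq> 0\<close>] sgn_mult by (simp only:) simp
qed

theorem theorem1p2:
  shows "(\<forall>\<Omega> w v. open \<Omega> \<longrightarrow> solves_wv_system \<Omega> w v \<longrightarrow>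
       solves_n4_system \<Omega> (\<lambda>z. U_of (w z) (v z))) \<and>
    (\<forall>P. P \<noteq> 0 \<longrightarrow>
       strictly_hyperbolic_at wv_matrix P \<and> eigenvalues (wv_matrix P) = {lambda1 P, lambda2 P}) \<and>
    (\<forall>P. P $ 1 \<noteq> 0 \<or> P $ 2 < 0 \<longrightarrow>
       is_eigenvector (wv_matrix P) (lambda1 P) (xi1 P) \<and> lambda1 differentiable (at P) \<and>
       sgn (nonlinearity lambda1 xi1 P) = sgn (P $ 2)) \<and>
    (\<forall>P. P $ 1 \<noteq> 0 \<or> P $ 2 > 0 \<longrightarrow>
       is_eigenvector (wv_matrix P) (lambda2 P) (xi2 P) \<and> lambda2 differentiable (at P) \<and>
       sgn (nonlinearity lambda2 xi2 P) = sgn (P $ 2))"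
proof (intro conjI allI impI)
  \<comment> \<open>\<open>frechet_derivative\<close> is a choice operator; differentiability
    ensures that \<open>nonlinearity\<close> is a genuine directional derivative.\<close>
  show "lambda1 differentiable (at P)" if "P $ 1 \<noteq> 0 \<or> P $ 2 < 0" for P
  proof -
    have "P \<noteq> 0" using that by auto
    then show ?thesis by (rule differentiableI[OF lambda_has_derivative(1)])
  qed
  show "lambda2 differentiable (at P)" if "P $ 1 \<noteq> 0 \<or> P $ 2 > 0" for P
  proof -
    have "P \<noteq> 0" using that by auto
    then show ?thesis by (rule differentiableI[OF lambda_has_derivative(2)])
  qed
qed (simp_all add: U_of_solves_n4_system strictly_hyperbolic_wv_matrix eigenvalues_wv_matrix
  is_eigenvector_xi1 sgn_nonlinearity_lambda1 is_eigenvector_xi2 sgn_nonlinearity_lambda2)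

end
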